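(* Let $q=(x,y,z)\in J^+(q_0)$. Then $$d(q)=\sqrt{x^2-y^2}\cdot\frac{p}{\sinh p},\qquad p=\beta\left(\frac{z}{x^2-y^2}\right).$$ In particular: (1) $z=0\iff d(q)=\sqrt{x^2-y^2}$, (2) $q\in J^+(q_0)\setminus I^+(q_0)\iff d(q)=0$.
   Context: $M=\mathbb R^3_{x,y,z}$ is the Heisenberg group with product $(x_1,y_1,z_1)\cdot(x_2,y_2,z_2)=(x_1+x_2,\,y_1+y_2,\,z_1+z_2+(x_1y_2-x_2y_1)/2)$, $q_0=(0,0,0)$, $X_1=\frac{\partial}{\partial x}-\frac y2\frac{\partial}{\partial z}$, $X_2=\frac{\partial}{\partial y}+\frac x2\frac{\partial}{\partial z}$. Admissible trajectories are Lipschitz curves $q:[0,t_1]\to M$ with $\dot q=u_1X_1(q)+u_2X_2(q)$, $u_1\ge|u_2|$ a.e.; their length is $l(q(\cdot))=\int_0^{t_1}\sqrt{u_1^2-u_2^2}\,dt$. The causal future $J^+(q_0)$ is the set of points reachable from $q_0$ (in nonnegative time) by admissible trajectories, and the chronological future $I^+(q_0)$ is the set of points reachable in positive time by trajectories with $u_1>|u_2|$ a.e. It is known that $J^+(q_0)=\{-x^2+y^2+4|z|\le0,\ x\ge0\}$ and $I^+(q_0)=\{-x^2+y^2+4|z|<0,\ x>0\}$. For $q\in J^+(q_0)$ the sub-Lorentzian distance $d(q)=d(q_0,q)$ is the supremum of $l$ over all admissible trajectories from $q_0$ to $q$ ($d(q_0)=0$). The function $\beta:(-\frac14,\frac14)\to\mathbb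 R$ is the inverse of the diffeomorphism $\alpha:\mathbb R\to(-\frac14,\frac14)$, $\alpha(p)=\frac{\sinh2p-2p}{8\sinh^2p}$, $\alpha(0)=0$. Conventions: $\beta(\pm\frac14)=\pm\infty$, and by continuity $\frac{p}{\sinh p}=1$ for $p=0$ and $\frac{p}{\sinh p}=0$ for $p=\pm\infty$. At points of $J^+(q_0)$ with $x=|y|$ (where necessarily $z=0$) the right-hand side of the formula is understood to be $0$. *)

theory Defs
  imports "HOL-Analysis.Analysis"
begin

type_synonym point = "real \<times> real \<times> real"

definition q0 :: point where
  "q0 = (0, 0, 0)"

fun X1 :: "point \<Rightarrow> point" where
  "X1 (x, y, z) = (1, 0, - y / 2)"

fun X2 :: "point \<Rightarrow> point" where
  "X2 (x, y, z) = (0, 1, x / 2)"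

text \<open>
  The controls are the almost everywhere derivatives of the first two coordinates of the
  Lipschitz curve \<open>q\<close>. Hence they are determined by \<open>q\<close> up to null sets, and they are
  automatically Lebesgue measurable and essentially bounded on \<open>[0, t1]\<close>; in particular the
  integrand of the length below is integrable for every admissible trajectory.
\<close>

definition admissible ::
  "real \<Rightarrow> (real \<Rightarrow> point) \<Rightarrow> (real \<Rightarrow> real) \<Rightarrow> (real \<Rightarrow> real) \<Rightarrow> bool" where
  "admissible t1 q u1 u2 \<longleftrightarrow>
     0 \<le> t1 \<and>
     (\<exists>L. L-lipschitz_on {0..t1} q) \<and>
     (AE t in lebesgue_on {0..t1}.
        (q has_vector_derivative (u1 t *\<^sub>R X1 (q t) + u2 t *\<^sub>R X2 (q t))) (at t within {0..t1}) \<and>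
        \<bar>u2 t\<bar> \<le> u1 t)"

definition sl_length :: "real \<Rightarrow> (real \<Rightarrow> real) \<Rightarrow> (real \<Rightarrow> real) \<Rightarrow> real" where
  "sl_length t1 u1 u2 = (LINT t|lebesgue_on {0..t1}. sqrt ((u1 t)\<^sup>2 - (u2 t)\<^sup>2))"

definition causal_future :: "point \<Rightarrow> point set" where
  "causal_future a = {b. \<exists>t1 q u1 u2. admissible t1 q u1 u2 \<and> q 0 = a \<and> q t1 = b}"

definition chronological_future :: "point \<Rightarrow> point set" where
  "chronological_future a =
     {b. \<exists>t1 q u1 u2. 0 < t1 \<and> admissible t1 q u1 u2 \<and>
           (AE t in lebesgue_on {0..t1}. \<bar>u2 t\<bar> < u1 t) \<and> q 0 = a \<and> q t1 = b}"

text \<open>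
  The supremum is taken in the extended reals, so an equation between the distance and a real
  number includes the finiteness of the supremum. Only the values for \<open>b\<close> in the causal future
  of \<open>a\<close> are meaningful; elsewhere this is the supremum of the empty set.
\<close>

definition sl_dist :: "point \<Rightarrow> point \<Rightarrow> ereal" where
  "sl_dist a b =
     Sup {ereal (sl_length t1 u1 u2) | t1 q u1 u2. admissible t1 q u1 u2 \<and> q 0 = a \<and> q t1 = b}"

definition \<alpha> :: "real \<Rightarrow> real" where
  "\<alpha> p = (if p = 0 then 0 else (sinh (2 * p) - 2 * p) / (8 * (sinh p)\<^sup>2))"

text \<open>Only the values on the closed interval \<open>[-1/4, 1/4]\<close> are meaningful.\<close>

definition \<beta> :: "real \<Rightarrow> ereal" where
  "\<beta> s = (if s = 1 / 4 then \<infinity> else if s = - 1 / 4 then - \<infinity> else ereal (inv \<alpha> s))"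

definition over_sinh :: "ereal \<Rightarrow> real" where
  "over_sinh p =
     (if \<bar>p\<bar> = \<infinity> then 0
      else if p = 0 then 1
      else real_of_ereal p / sinh (real_of_ereal p))"

end

(* For a fixed multiplier k, the function W - k z with W = calib k r, r = sqrt (x^2 - y^2) and
   dW/dr = sqrt (1 + (k r / 2)^2) grows along every admissible curve at least as fast as the length:
   this is the reverse Cauchy-Schwarz inequality in the Minkowski plane. Hence every length is at most
   W - k z, and k = 2 sinh p / r turns this into r ((p / sinh p + cosh p) / 2 - 2 sinh p (z / r^2)).
   For z / r^2 = alpha p the bound equals r p / sinh p and is attained by an arc of a hyperbola;
   for |z| / r^2 = 1/4 it tends to 0 as |p| tends to infinity with p of the sign of z. *)

theory Submission
  imports Defs "HOL-Real_Asymp.Real_Asymp"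
begin

text \<open>The multiplier k is the constant vertical momentum of an extremal, and geometrically the
  curvature of its projection to the Minkowski plane. An arc of speed c = r p / sinh p whose
  rapidity grows at rate 2 p has curvature 2 p / c = 2 sinh p / r, which is where that value of k
  comes from. Equality in the reverse Cauchy-Schwarz inequality means that the velocity has rapidity
  arsinh (k r / 2) relative to the position, as it has along this arc. Two obstacles shape the
  proof. Trajectories are only Lipschitz and their equations hold only almost everywhere, so every
  growth statement must come from integrating an almost everywhere derivative. Moreover every
  trajectory starts at r = 0, where r is not smooth. The chronological future is recognised through
  lengths: a point of it has positive distance, hence is not on the boundary 4 |z| = x^2 - y^2,
  while the hyperbolic arcs have strictly timelike controls and reach every other point of the
  causal future.\<close>

section \<open>Integrating the almost everywhere derivative of a Lipschitz function\<close>

lemma AE_lebesgue_on_obtain_null: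
  assumes "AE x in lebesgue_on S. P x" "S \<in> sets lebesgue"
  obtains N where "N \<in> null_sets (lebesgue_on S)" "\<And>x. x \<in> S - N \<Longrightarrow> P x"
  using assms by (auto simp: eventually_ae_filter)

lemma AE_lebesgue_on_subset:
  assumes "AE x in lebesgue_on S. P x" "A \<subseteq> S" "A \<in> sets lebesgue" "S \<in> sets lebesgue"
  shows "AE x in lebesgue_on A. P x"
  using assms by (auto simp: AE_restrict_space_iff elim: eventually_mono)

text \<open>Lebesgue measure is complete, so removing the null set where convergence fails changes
  nothing about measurability, and off that set the limit is pointwise.\<close>

lemma borel_measurable_lebesgue_on_AE_LIMSEQ:
  fixes g :: "'a::euclidean_space \<Rightarrow> 'b::euclidean_space"
  assumes S: "S \<in> sets lebesgue"
    and s: "\<And>n. s n \<in> borel_measurable (lebesgue_on S)"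
    and lim: "AE x in lebesgue_on S. (\<lambda>n. s n x) \<longlonglongrightarrow> g x"
  shows "g \<in> borel_measurable (lebesgue_on S)"
proof -
  obtain N where N: "N \<in> null_sets (lebesgue_on S)" "\<And>x. x \<in> S - N \<Longrightarrow> (\<lambda>n. s n x) \<longlonglongrightarrow> g x"
    using AE_lebesgue_on_obtain_null[OF lim S] by blast
  have "g \<in> borel_measurable (lebesgue_on (S - N))"
  proof (rule borel_measurable_LIMSEQ_metric[where f = s])
    show "s n \<in> borel_measurable (lebesgue_on (S - N))" for n
      using borel_measurable_diff_null[OF N(1) S] s by blast
  qed (use N in auto)
  then show ?thesis
    using borel_measurable_diff_null[OF N(1) S] by blast
qed

lemma AE_lebesgue_on_neq: "AE x in lebesgue_on S. x \<noteq> (c::'a::euclidean_space)" if "S \<in> sets lebesgue"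
proof -
  have "AE x in lebesgue. x \<noteq> c"
    using AE_lborel_singleton[of c] by (rule AE_completion)
  then show ?thesis
    using that by (simp add: AE_restrict_space_iff) (auto elim: AE_mp)
qed

text \<open>Dominated convergence speaks of sequences, so the derivative is sampled along the
  increments 1 / (n + 1). The second hypothesis keeps the sample points in \<open>S\<close>, where a
  derivative within \<open>S\<close> controls them.\<close>

lemma has_vector_derivative_seq_quotient:
  fixes F :: "real \<Rightarrow> 'b::real_normed_vector"
  assumes "(F has_vector_derivative v) (at t within S)"
    and "\<forall>\<^sub>F n in sequentially. t + 1 / real (Suc n) \<in> S"
  shows "(\<lambda>n. real (Suc n) *\<^sub>R (F (t + 1 / real (Suc n)) - F t)) \<longlonglongrightarrow> v"
proof -
  let ?h = "\<lambda>n. 1 / real (Suc n)"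
  have lim: "((\<lambda>y. (1 / norm (y - t)) *\<^sub>R (F y - (F t + (y - t) *\<^sub>R v))) \<longlongrightarrow> 0) (at t within S)"
    using assms(1) by (simp add: has_vector_derivative_def has_derivative_within)
  have "?h \<longlonglongrightarrow> 0" using LIMSEQ_inverse_real_of_nat by (simp add: field_simps)
  then have "(\<lambda>n. t + ?h n) \<longlonglongrightarrow> t" by (auto intro: tendsto_eq_intros)
  then have "filterlim (\<lambda>n. t + ?h n) (at t within S) sequentially"
    using assms(2) by (auto simp: filterlim_at)
  from filterlim_compose[OF lim this]
  have "(\<lambda>n. real (Suc n) *\<^sub>R (F (t + ?h n) - (F t + ?h n *\<^sub>R v))) \<longlonglongrightarrow> 0"
    by simp
  moreover have "real (Suc n) *\<^sub>R (F (t + ?h n) - (F t + ?h n *\<^sub>R v))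
      = real (Suc n) *\<^sub>R (F (t + ?h n) - F t) - v" for n
    by (simp add: algebra_simps del: of_nat_Suc)
  ultimately show ?thesis by (simp only: LIM_zero_iff)
qed

text \<open>The difference quotients are bounded by the Lipschitz constant, so dominated convergence
  replaces absolute continuity.\<close>

lemma lipschitz_has_bochner_integral:
  fixes F :: "real \<Rightarrow> 'b::euclidean_space"
  assumes ab: "a \<le> b" and lip: "L-lipschitz_on {a..b} F"
    and der: "AE t in lebesgue_on {a..b}. (F has_vector_derivative g t) (at t within {a..b})"
  shows "has_bochner_integral (lebesgue_on {a..b}) g (F b - F a)"
proof -
  \<comment> \<open>Clamping to [a, b] does not increase distances, so \<open>E\<close> extends
    \<open>F\<close> to the whole line with the same Lipschitz constant and its difference quotients
    are defined up to the right end.\<close>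
  define c where "c t = max a (min b t)" for t
  define E where "E t = F (c t)" for t
  define s where "s n t = real (Suc n) *\<^sub>R (E (t + 1 / real (Suc n)) - E t)" for n t
  have c_in: "c t \<in> {a..b}" for t using ab by (auto simp: c_def)
  have c_dist: "dist (c t) (c u) \<le> dist t u" for t u
    by (auto simp: c_def dist_real_def max_def min_def abs_if)
  have L0: "0 \<le> L" using lip by (rule lipschitz_on_nonneg)
  have E_lip: "L-lipschitz_on UNIV E"
  proof (rule lipschitz_onI)
    fix t u
    have "dist (E t) (E u) \<le> L * dist (c t) (c u)"
      unfolding E_def using lipschitz_onD[OF lip c_in c_in] .
    also have "\<dots> \<le> L * dist t u" using c_dist L0 by (intro mult_left_mono)
    finally show "dist (E t) (E u) \<le> L * dist t u" .
  qed (rule L0)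
  have E_cont: "continuous_on A E" for A
    using lipschitz_on_continuous_on[OF E_lip] continuous_on_subset by blast
  \<comment> \<open>The margins leave room for the increments, which are at most 1:
    \<open>G0\<close> is differentiable from both sides on [a, b + 1].\<close>
  obtain G0 where G0: "\<And>t. t \<in> {a - 1..b + 2} \<Longrightarrow> (G0 has_vector_derivative E t) (at t within {a-1..b+2})"
    using antiderivative_continuous[OF E_cont] by blast
  have G: "(G0 has_vector_derivative E t) (at t)" if "t \<in> {a..b+1}" for t
  proof -
    have "t \<in> interior {a-1..b+2}" using that by auto
    then show ?thesis using G0[of t] that at_within_interior[of t "{a-1..b+2}"] by auto
  qed
  have s_meas: "s n \<in> borel_measurable (lebesgue_on {a..b})" for n
    unfolding s_def
    by (intro continuous_imp_measurable_on_sets_lebesgue continuous_intros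
          continuous_on_compose2[OF E_cont[of UNIV]]) auto
  have s_lim: "AE t in lebesgue_on {a..b}. (\<lambda>n. s n t) \<longlonglongrightarrow> g t"
  proof -
    have "AE t in lebesgue_on {a..b}. t \<in> {a..b}"
      by (rule AE_I2) simp
    \<comment> \<open>At t = b every increment leaves the interval, and the derivative within it
      says nothing about \<open>E\<close> there.\<close>
    moreover have "AE t in lebesgue_on {a..b}. t \<noteq> b"
      by (rule AE_lebesgue_on_neq) simp
    ultimately show ?thesis using der
    proof eventually_elim
      case (elim t)
      then have t: "a \<le> t" "t < b" by auto
      have "(\<lambda>n. 1 / real (Suc n)) \<longlonglongrightarrow> 0"
        using LIMSEQ_inverse_real_of_nat by (simp add: field_simps)
      then have "\<forall>\<^sub>F n in sequentially. 1 / real (Suc n) < b - t"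
        by (rule order_tendstoD) (use t in simp)
      then have ev: "\<forall>\<^sub>F n in sequentially. t + 1 / real (Suc n) \<in> {a..b}"
        by eventually_elim (use t in \<open>auto intro: add_increasing2\<close>)
      have "(\<lambda>n. real (Suc n) *\<^sub>R (F (t + 1 / real (Suc n)) - F t)) \<longlonglongrightarrow> g t"
        using has_vector_derivative_seq_quotient[OF elim(3) ev] .
      then show ?case
      proof (rule Lim_transform_eventually)
        show "\<forall>\<^sub>F n in sequentially. real (Suc n) *\<^sub>R (F (t + 1 / real (Suc n)) - F t) = s n t"
          using ev by eventually_elim (use t in \<open>auto simp: s_def E_def c_def min_absorb2 max_absorb2\<close>)
      qed
    qed
  qed
  have g_meas: "g \<in> borel_measurable (lebesgue_on {a..b})"
    by (rule borel_measurable_lebesgue_on_AE_LIMSEQ[OF _ s_meas s_lim]) simp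
  have bound: "AE t in lebesgue_on {a..b}. norm (s n t) \<le> L" for n
  proof (rule AE_I2)
    fix t
    have "norm (E (t + 1 / real (Suc n)) - E t) \<le> L * (1 / real (Suc n))"
      using lipschitz_onD[OF E_lip, of "t + 1 / real (Suc n)" t] by (simp add: dist_norm)
    then show "norm (s n t) \<le> L"
      unfolding s_def norm_scaleR by (simp add: pos_le_divide_eq mult.commute del: of_nat_Suc)
  qed
  have w: "integrable (lebesgue_on {a..b}) (\<lambda>_. L)" by simp
  have int: "integrable (lebesgue_on {a..b}) g"
    and lim1: "(\<lambda>n. integral\<^sup>L (lebesgue_on {a..b}) (s n)) \<longlonglongrightarrow> integral\<^sup>L (lebesgue_on {a..b}) g"
    using integrable_dominated_convergence[OF g_meas s_meas w s_lim bound]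
      integral_dominated_convergence[OF g_meas s_meas w s_lim bound] by auto
  define Q where "Q t n = real (Suc n) *\<^sub>R (G0 (t + 1 / real (Suc n)) - G0 t)" for t n
  have Qlim: "Q t \<longlonglongrightarrow> E t" if "t \<in> {a..b}" for t
    unfolding Q_def using that by (intro has_vector_derivative_seq_quotient[OF G]) auto
  \<comment> \<open>The integral of a difference quotient of \<open>E\<close> is the difference of
    the quotients of its antiderivative at b and a, and these converge to \<open>E b\<close> and
    \<open>E a\<close>.\<close>
  have "integral\<^sup>L (lebesgue_on {a..b}) (s n) = Q b n - Q a n" for n
  proof -
    have "(s n has_integral (Q b n - Q a n)) {a..b}"
    proof (rule fundamental_theorem_of_calculus[OF ab])
      fix t assume t: "t \<in> {a..b}"
      have 1: "(G0 has_vector_derivative E t) (at t)" using t by (intro G) auto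
      have "t + 1 / real (Suc n) \<in> {a..b+1}"
        using t by (auto intro: add_increasing2 add_mono)
      then have "(G0 has_vector_derivative E (t + 1 / real (Suc n))) (at (t + 1 / real (Suc n)))"
        by (rule G)
      moreover have "((\<lambda>t. t + 1 / real (Suc n)) has_vector_derivative 1) (at t)"
        using has_vector_derivative_add[OF has_vector_derivative_id has_vector_derivative_const] by simp
      ultimately have "((\<lambda>t. G0 (t + 1 / real (Suc n))) has_vector_derivative E (t + 1 / real (Suc n))) (at t)"
        using vector_diff_chain_at[of "\<lambda>t. t + 1 / real (Suc n)" 1 t G0] by (simp only: o_def scaleR_one)
      then show "((\<lambda>t. Q t n) has_vector_derivative s n t) (at t within {a..b})"
        unfolding Q_def s_def using 1
        by (intro has_vector_derivative_at_within[OF bounded_linear.has_vector_derivative[OF bounded_linear_scaleR_right]]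
            has_vector_derivative_diff)
    qed
    moreover have "integrable (lebesgue_on {a..b}) (s n)"
      using integrable_dominated_convergence2[OF g_meas s_meas w s_lim bound] .
    ultimately show ?thesis
      by (simp add: lebesgue_integral_eq_integral integral_unique)
  qed
  then have "(\<lambda>n. integral\<^sup>L (lebesgue_on {a..b}) (s n)) \<longlonglongrightarrow> E b - E a"
    using tendsto_diff[OF Qlim Qlim, of b a] ab by simp
  moreover have "E b = F b" "E a = F a" using ab by (auto simp: E_def c_def)
  ultimately have "integral\<^sup>L (lebesgue_on {a..b}) g = F b - F a"
    using lim1 LIMSEQ_unique by metis
  then show ?thesis using int by (simp add: has_bochner_integral_iff)
qed

section \<open>Lipschitz bounds on compact intervals\<close>

text \<open>Both factors are bounded because the interval is compact. This covers quadratic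
  expressions such as x^2 - y^2 along a trajectory.\<close>

lemma lipschitz_on_bounded_mult:
  fixes f g :: "real \<Rightarrow> real"
  assumes "\<exists>L. L-lipschitz_on {a..b} f" "\<exists>L. L-lipschitz_on {a..b} g"
  shows "\<exists>L. L-lipschitz_on {a..b} (\<lambda>t. f t * g t)"
proof -
  obtain C D where C: "C-lipschitz_on {a..b} f" and D: "D-lipschitz_on {a..b} g"
    using assms by blast
  have "bounded (f ` {a..b})" "bounded (g ` {a..b})"
    using lipschitz_on_continuous_on[OF C] lipschitz_on_continuous_on[OF D]
    by (auto intro!: compact_imp_bounded compact_continuous_image)
  then obtain M N where M: "\<And>t. t \<in> {a..b} \<Longrightarrow> \<bar>f t\<bar> \<le> M" "0 < M"
    and N: "\<And>t. t \<in> {a..b} \<Longrightarrow> \<bar>g t\<bar> \<le> N" "0 < N"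
    unfolding bounded_pos by (metis imageI real_norm_def)
  have nn: "0 \<le> C" "0 \<le> D" using C D by (auto dest: lipschitz_on_nonneg)
  have "(M * D + N * C)-lipschitz_on {a..b} (\<lambda>t. f t * g t)"
  proof (rule lipschitz_onI)
    fix s t assume st: "s \<in> {a..b}" "t \<in> {a..b}"
    have "\<bar>f s * g s - f t * g t\<bar> = \<bar>f s * (g s - g t) + g t * (f s - f t)\<bar>"
      by (simp add: algebra_simps)
    also have "\<dots> \<le> \<bar>f s\<bar> * \<bar>g s - g t\<bar> + \<bar>g t\<bar> * \<bar>f s - f t\<bar>"
      by (metis abs_mult abs_triangle_ineq)
    also have "\<dots> \<le> M * (D * dist s t) + N * (C * dist s t)"
      using lipschitz_onD[OF C st] lipschitz_onD[OF D st] M N st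
      by (intro add_mono mult_mono) (auto simp: dist_real_def)
    finally show "dist (f s * g s) (f t * g t) \<le> (M * D + N * C) * dist s t"
      by (simp add: dist_real_def algebra_simps)
  qed (use nn M N in auto)
  then show ?thesis by blast
qed

lemma C1_imp_lipschitz_on_Icc:
  fixes h :: "real \<Rightarrow> real"
  assumes "\<And>w. w \<in> {c..d} \<Longrightarrow> (h has_real_derivative h' w) (at w)"
    and "continuous_on {c..d} h'"
  shows "\<exists>L. L-lipschitz_on {c..d} h"
proof -
  have "bounded (h' ` {c..d})"
    using assms(2) by (auto intro!: compact_imp_bounded compact_continuous_image)
  then obtain M where M: "\<And>t. t \<in> {c..d} \<Longrightarrow> \<bar>h' t\<bar> \<le> M" "0 < M"
    unfolding bounded_pos by (metis imageI real_norm_def)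
  have "M-lipschitz_on {c..d} h"
  proof (rule lipschitz_onI)
    fix s t assume st: "s \<in> {c..d}" "t \<in> {c..d}"
    have "norm (h s - h t) \<le> M * norm (s - t)"
      by (rule field_differentiable_bound[where S = "{c..d}" and f' = h'])
         (use assms(1) M st in \<open>auto intro: has_field_derivative_at_within\<close>)
    then show "dist (h s) (h t) \<le> M * dist s t" by (simp add: dist_norm)
  qed (use M in simp)
  then show ?thesis ..
qed

section \<open>The calibrating function and the reverse Cauchy-Schwarz inequality\<close>

text \<open>The antiderivative of \<open>\<lambda>r. sqrt (1 + (k * r / 2)\<^sup>2)\<close> vanishing at \<open>0\<close>.\<close>

definition calib :: "real \<Rightarrow> real \<Rightarrow> real" where
  "calib k r = (if k = 0 then r else arsinh (k * r / 2) / k + r / 2 * sqrt (1 + (k * r / 2)\<^sup>2))"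

lemma calib_0 [simp]: "calib k 0 = 0"
  by (simp add: calib_def)

lemma calib_has_real_derivative:
  "(calib k has_real_derivative sqrt (1 + (k * r / 2)\<^sup>2)) (at r within A)"
proof (cases "k = 0")
  case True
  then have "calib k = (\<lambda>r. r)" by (auto simp: calib_def)
  then show ?thesis using True by simp
next
  case False
  define S where "S = sqrt (1 + (k * r / 2)\<^sup>2)"
  have pos: "1 + (k * r / 2)\<^sup>2 > 0" by (smt (verit) zero_le_power2)
  then have S: "S > 0" "S * S = 1 + (k * r / 2)\<^sup>2" by (auto simp: S_def)
  have eq: "calib k = (\<lambda>r. arsinh (k * r / 2) / k + r / 2 * sqrt (1 + (k * r / 2)\<^sup>2))"
    using False by (auto simp: calib_def)
  have "(calib k has_real_derivative
      (1 / sqrt ((k * r / 2)\<^sup>2 + 1) * (k / 2) / k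
        + (1 / 2 * sqrt (1 + (k * r / 2)\<^sup>2)
        + r / 2 * (inverse (sqrt (1 + (k * r / 2)\<^sup>2)) / 2 * (2 * (k * r / 2) * (k / 2)))))) (at r within A)"
    unfolding eq using pos
    by (auto intro!: derivative_eq_intros DERIV_chain2[OF arsinh_real_has_field_derivative] simp: add.commute)
  also have "1 / sqrt ((k * r / 2)\<^sup>2 + 1) * (k / 2) / k
        + (1 / 2 * sqrt (1 + (k * r / 2)\<^sup>2)
        + r / 2 * (inverse (sqrt (1 + (k * r / 2)\<^sup>2)) / 2 * (2 * (k * r / 2) * (k / 2))))
      = (1 / 2 + S * S / 2 + (k * r / 2)\<^sup>2 / 2) / S"
    using False S(1) unfolding add.commute[of "(k * r / 2)\<^sup>2"] S_def[symmetric]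
    by (simp add: field_simps power2_eq_square)
  also have "1 / 2 + S * S / 2 + (k * r / 2)\<^sup>2 / 2 = S * S"
    using S(2) by linarith

  also have "S * S / S = S" using S(1) by simp
  finally show ?thesis by (simp add: S_def)
qed

lemma isCont_calib: "isCont (calib k) r"
  using calib_has_real_derivative DERIV_isCont by blast

text \<open>The vector (sqrt (1 + m^2), m) has Minkowski norm 1. The square of the right-hand side
  exceeds A^2 - B^2 by the square of m A - sqrt (1 + m^2) B, so equality holds exactly when this
  vanishes.\<close>

lemma reverse_Cauchy_Schwarz:
  fixes A B m :: real
  assumes "\<bar>B\<bar> \<le> A"
  shows "sqrt (A\<^sup>2 - B\<^sup>2) \<le> sqrt (1 + m\<^sup>2) * A - m * B"
proof -
  define S where "S = sqrt (1 + m\<^sup>2)"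
  have S: "S\<^sup>2 = 1 + m\<^sup>2" by (simp add: S_def add_nonneg_nonneg)
  have mS: "\<bar>m\<bar> \<le> S" unfolding S_def by (rule real_le_rsqrt) simp
  have "m * B \<le> \<bar>m\<bar> * \<bar>B\<bar>" by (metis abs_ge_self abs_mult)
  also have "\<dots> \<le> S * A" using assms mS by (intro mult_mono) auto
  finally have "0 \<le> S * A - m * B" by simp
  moreover have "(S * A - m * B)\<^sup>2 = A\<^sup>2 - B\<^sup>2 + (m * A - S * B)\<^sup>2"
    using S by (simp add: power2_eq_square) algebra
  ultimately show ?thesis
    unfolding S_def by (intro real_le_lsqrt) auto
qed

section \<open>Estimates along a causal curve starting at the origin\<close>

text \<open>Working in coordinates reduces all estimates to scalar functions. A locale over the
  final time lets a result about the endpoint be applied to every initial segment.\<close>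

locale causal_curve =
  fixes T :: real and x y z u1 u2 :: "real \<Rightarrow> real"
  assumes T_nonneg: "0 \<le> T"
    and lip_x: "\<exists>L. L-lipschitz_on {0..T} x"
    and lip_y: "\<exists>L. L-lipschitz_on {0..T} y"
    and lip_z: "\<exists>L. L-lipschitz_on {0..T} z"
    and AE_der: "AE t in lebesgue_on {0..T}.
      (x has_real_derivative u1 t) (at t within {0..T}) \<and>
      (y has_real_derivative u2 t) (at t within {0..T}) \<and>
      (z has_real_derivative (x t * u2 t - y t * u1 t) / 2) (at t within {0..T}) \<and>
      \<bar>u2 t\<bar> \<le> u1 t"
    and start: "x 0 = 0" "y 0 = 0" "z 0 = 0"
begin

lemma AE_dom: "AE t in lebesgue_on {0..T}. t \<in> {0..T}"
  by (rule AE_I2) simp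

lemma restrict:
  assumes "t \<in> {0..T}" shows "causal_curve t x y z u1 u2"
proof
  have sub: "{0..t} \<subseteq> {0..T}" using assms by auto
  show "\<exists>L. L-lipschitz_on {0..t} x" "\<exists>L. L-lipschitz_on {0..t} y" "\<exists>L. L-lipschitz_on {0..t} z"
    using lip_x lip_y lip_z lipschitz_on_subset[OF _ sub] by blast+
  have "AE s in lebesgue_on {0..t}. (x has_real_derivative u1 s) (at s within {0..T}) \<and>
      (y has_real_derivative u2 s) (at s within {0..T}) \<and>
      (z has_real_derivative (x s * u2 s - y s * u1 s) / 2) (at s within {0..T}) \<and>
      \<bar>u2 s\<bar> \<le> u1 s"
    by (rule AE_lebesgue_on_subset[OF AE_der sub]) auto
  then show "AE s in lebesgue_on {0..t}. (x has_real_derivative u1 s) (at s within {0..t}) \<and>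
      (y has_real_derivative u2 s) (at s within {0..t}) \<and>
      (z has_real_derivative (x s * u2 s - y s * u1 s) / 2) (at s within {0..t}) \<and>
      \<bar>u2 s\<bar> \<le> u1 s"
    by eventually_elim (use sub in \<open>blast intro: DERIV_subset\<close>)
qed (use assms start in auto)

lemma has_bochner_integral_derivative:
  assumes "\<exists>L. L-lipschitz_on {0..T} F"
    and "AE t in lebesgue_on {0..T}. (F has_real_derivative g t) (at t within {0..T})"
  shows "has_bochner_integral (lebesgue_on {0..T}) g (F T - F 0)"
  using assms lipschitz_has_bochner_integral[OF T_nonneg, of _ F g]
  by (auto simp: has_real_derivative_iff_has_vector_derivative)

text \<open>A nonnegative derivative almost everywhere alone does not control increments, since
  singular parts may occur; the Lipschitz bound makes \<open>F T - F 0\<close> the integral of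
  \<open>g\<close>.\<close>

lemma endpoint_le:
  assumes "\<exists>L. L-lipschitz_on {0..T} F"
    and "AE t in lebesgue_on {0..T}. (F has_real_derivative g t) (at t within {0..T}) \<and> 0 \<le> g t"
  shows "F 0 \<le> F T"
proof -
  have "has_bochner_integral (lebesgue_on {0..T}) g (F T - F 0)"
    by (rule has_bochner_integral_derivative) (use assms in auto)
  then have "F T - F 0 = integral\<^sup>L (lebesgue_on {0..T}) g"
    by (simp add: has_bochner_integral_iff)
  also have "\<dots> \<ge> 0"
    using assms(2) by (intro integral_nonneg_AE) (auto elim: eventually_mono)
  finally show ?thesis by simp
qed

lemma lip_add: "\<exists>L. L-lipschitz_on {0..T} f \<Longrightarrow> \<exists>L. L-lipschitz_on {0..T} g \<Longrightarrow>
    \<exists>L. L-lipschitz_on {0..T} (\<lambda>t. f t + g t :: real)"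
  by (blast intro: lipschitz_on_add)

lemma lip_diff: "\<exists>L. L-lipschitz_on {0..T} f \<Longrightarrow> \<exists>L. L-lipschitz_on {0..T} g \<Longrightarrow>
    \<exists>L. L-lipschitz_on {0..T} (\<lambda>t. f t - g t :: real)"
  by (blast intro: lipschitz_on_diff)

lemma lip_const: "\<exists>L. L-lipschitz_on {0..T} (\<lambda>t. c :: real)"
  by (blast intro: lipschitz_on_constant)

lemmas lip_intros = lip_add lip_diff lip_const lipschitz_on_bounded_mult lip_x lip_y lip_z

text \<open>The null coordinates x - y and x + y have the nonnegative derivatives u1 - u2 and u1 +
  u2.\<close>

lemma endpoint_abs_y_le: "\<bar>y T\<bar> \<le> x T"
proof -
  have "x 0 - y 0 \<le> x T - y T"
    by (rule endpoint_le[where F = "\<lambda>t. x t - y t" and g = "\<lambda>t. u1 t - u2 t"])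
       (intro lip_intros, use AE_der in \<open>eventually_elim\<close>, auto intro!: derivative_intros)
  moreover have "x 0 + y 0 \<le> x T + y T"
    by (rule endpoint_le[where F = "\<lambda>t. x t + y t" and g = "\<lambda>t. u1 t + u2 t"])
       (intro lip_intros, use AE_der in \<open>eventually_elim\<close>, auto intro!: derivative_intros)
  ultimately show ?thesis using start by auto
qed

lemma abs_y_le: "t \<in> {0..T} \<Longrightarrow> \<bar>y t\<bar> \<le> x t"
  by (rule causal_curve.endpoint_abs_y_le[OF restrict])

text \<open>The derivative of x^2 - y^2 - 4 z factors as 2 (x + y) (u1 - u2), and that of x^2 - y^2
  + 4 z as 2 (x - y) (u1 + u2). All factors are nonnegative; this is the source of the bound
  1/4.\<close>

lemma cone: "4 * \<bar>z T\<bar> \<le> (x T)\<^sup>2 - (y T)\<^sup>2"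
proof -
  have "x 0 * x 0 - y 0 * y 0 - 4 * z 0 \<le> x T * x T - y T * y T - 4 * z T"
  proof (rule endpoint_le[where F = "\<lambda>t. x t * x t - y t * y t - 4 * z t"
        and g = "\<lambda>t. 2 * ((x t + y t) * (u1 t - u2 t))"])
    show "AE t in lebesgue_on {0..T}. ((\<lambda>t. x t * x t - y t * y t - 4 * z t) has_real_derivative
        2 * ((x t + y t) * (u1 t - u2 t))) (at t within {0..T}) \<and> 0 \<le> 2 * ((x t + y t) * (u1 t - u2 t))"
      using AE_der AE_dom
    proof eventually_elim
      case (elim t)
      then have "0 \<le> (x t + y t) * (u1 t - u2 t)"
        using abs_y_le[of t] by (intro mult_nonneg_nonneg) auto
      moreover have "((\<lambda>t. x t * x t - y t * y t - 4 * z t) has_real_derivative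
          2 * ((x t + y t) * (u1 t - u2 t))) (at t within {0..T})"
        using elim by (auto intro!: derivative_eq_intros simp: field_simps)
      ultimately show ?case by simp
    qed
  qed (intro lip_intros)
  moreover have "x 0 * x 0 - y 0 * y 0 + 4 * z 0 \<le> x T * x T - y T * y T + 4 * z T"
  proof (rule endpoint_le[where F = "\<lambda>t. x t * x t - y t * y t + 4 * z t"
        and g = "\<lambda>t. 2 * ((x t - y t) * (u1 t + u2 t))"])
    show "AE t in lebesgue_on {0..T}. ((\<lambda>t. x t * x t - y t * y t + 4 * z t) has_real_derivative
        2 * ((x t - y t) * (u1 t + u2 t))) (at t within {0..T}) \<and> 0 \<le> 2 * ((x t - y t) * (u1 t + u2 t))"
      using AE_der AE_dom
    proof eventually_elim
      case (elim t)
      then have "0 \<le> (x t - y t) * (u1 t + u2 t)"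
        using abs_y_le[of t] by (intro mult_nonneg_nonneg) auto
      moreover have "((\<lambda>t. x t * x t - y t * y t + 4 * z t) has_real_derivative
          2 * ((x t - y t) * (u1 t + u2 t))) (at t within {0..T})"
        using elim by (auto intro!: derivative_eq_intros simp: field_simps)
      ultimately show ?case by simp
    qed
  qed (intro lip_intros)
  ultimately show ?thesis using start by (auto simp: power2_eq_square)
qed

text \<open>The starting point is moved off the light cone, where the calibrating function is not smooth.\<close>

lemma length_le_shifted:
  assumes e: "0 < e"
  shows "(LINT t|lebesgue_on {0..T}. sqrt ((u1 t)\<^sup>2 - (u2 t)\<^sup>2)) \<le>
    calib k (sqrt ((x T + e)\<^sup>2 - (y T)\<^sup>2)) - k * (z T + e * y T / 2) - calib k e"
proof -
  \<comment> \<open>Left translation by (e, 0, 0) maps (x, y, z) to (x + e, y, z + e y / 2) and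
    preserves the controls. \<open>w\<close> is the squared radius and \<open>F\<close> the
    calibration along the translated curve. Using r^2 as the variable keeps \<open>w\<close>
    polynomial in the coordinates.\<close>
  define w where "w t = (x t + e) * (x t + e) - y t * y t" for t
  define h where "h v = calib k (sqrt v)" for v
  define h' where "h' v = sqrt (1 + (k * sqrt v / 2)\<^sup>2) / (2 * sqrt v)" for v
  define F where "F t = h (w t) - (k * z t + (k * e / 2) * y t)" for t
  define g where "g t = h' (w t) * (2 * ((x t + e) * u1 t - y t * u2 t)) -
    (k * ((x t * u2 t - y t * u1 t) / 2) + (k * e / 2) * u2 t)" for t
  have h: "(h has_real_derivative h' v) (at v within A)" if "v > 0" for v A
  proof -
    have "(h has_real_derivative sqrt (1 + (k * sqrt v / 2)\<^sup>2) * (inverse (sqrt v) / 2)) (at v)"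
      unfolding h_def by (rule DERIV_chain2[OF calib_has_real_derivative DERIV_real_sqrt[OF that]])
    moreover have "sqrt (1 + (k * sqrt v / 2)\<^sup>2) * (inverse (sqrt v) / 2) = h' v"
      unfolding h'_def by (simp only: divide_inverse inverse_mult_distrib mult_ac)
    ultimately show ?thesis
      by (metis has_field_derivative_at_within)
  qed
  \<comment> \<open>The translated curve keeps its radius at least e, so \<open>h\<close> is only
    used where the square root is smooth, hence Lipschitz.\<close>
  have w_ge: "e * e \<le> w t" if "t \<in> {0..T}" for t
  proof -
    have "0 \<le> (x t - y t) * (x t + y t)" "0 \<le> e * x t"
      using abs_y_le[OF that] e by (auto intro!: mult_nonneg_nonneg)
    then show ?thesis by (simp add: w_def algebra_simps)
  qed
  have w_pos: "0 < w t" if "t \<in> {0..T}" for t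
    using w_ge[OF that] e by (meson less_le_trans mult_pos_pos)
  have lip_w: "\<exists>L. L-lipschitz_on {0..T} w"
    unfolding w_def by (intro lip_intros)
  then have "compact (w ` {0..T})"
    by (auto intro!: compact_continuous_image dest: lipschitz_on_continuous_on)
  then obtain M where M: "\<And>t. t \<in> {0..T} \<Longrightarrow> w t \<le> M"
    by (metis abs_le_D1 bounded_iff compact_imp_bounded imageI real_norm_def)
  have "\<exists>L. L-lipschitz_on {e * e..M} h"
  proof (rule C1_imp_lipschitz_on_Icc)
    have pos: "0 < v" if "v \<in> {e * e..M}" for v
      using that e by (smt (verit) atLeastAtMost_iff mult_pos_pos)
    then show "(h has_real_derivative h' v) (at v)" if "v \<in> {e * e..M}" for v
      using h that by blast
    show "continuous_on {e * e..M} h'"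
      unfolding h'_def by (intro continuous_intros) (auto dest: pos)
  qed
  then obtain D where D: "D-lipschitz_on {e * e..M} h" ..
  obtain C where C: "C-lipschitz_on {0..T} w" using lip_w ..
  have "D-lipschitz_on (w ` {0..T}) h"
    by (rule lipschitz_on_subset[OF D]) (use M w_ge in auto)
  then have "\<exists>L. L-lipschitz_on {0..T} (\<lambda>t. h (w t))"
    using lipschitz_on_compose2[OF C] by blast
  then have lip_F: "\<exists>L. L-lipschitz_on {0..T} F"
    unfolding F_def by (intro lip_intros)
  have key: "AE t in lebesgue_on {0..T}. (F has_real_derivative g t) (at t within {0..T}) \<and>
      sqrt ((u1 t)\<^sup>2 - (u2 t)\<^sup>2) \<le> g t \<and> 0 \<le> g t"
    using AE_der AE_dom
  proof eventually_elim
    case (elim t)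
    then have u: "\<bar>u2 t\<bar> \<le> u1 t" and t: "t \<in> {0..T}" by auto
    have "(w has_real_derivative 2 * ((x t + e) * u1 t - y t * u2 t)) (at t within {0..T})"
      unfolding w_def using elim by (auto intro!: derivative_eq_intros simp: algebra_simps)
    then have "((\<lambda>t. h (w t)) has_real_derivative
        h' (w t) * (2 * ((x t + e) * u1 t - y t * u2 t))) (at t within {0..T})"
      by (rule DERIV_chain2[where f = h and g = w, OF h[where A = UNIV, OF w_pos[OF t]]])
    then have 1: "(F has_real_derivative g t) (at t within {0..T})"
      unfolding F_def g_def using elim by (intro DERIV_diff DERIV_add DERIV_cmult) blast+
    define r where "r = sqrt (w t)"
    \<comment> \<open>\<open>A\<close> and \<open>B\<close> are the components of the velocity after
      the boost that takes the position direction to the x-axis. \<open>A\<close> is the derivative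
      of r, r B / 2 is the derivative of the translated z, and the boost preserves the Minkowski
      form.\<close>
    define A where "A = ((x t + e) * u1 t - y t * u2 t) / r"
    define B where "B = ((x t + e) * u2 t - y t * u1 t) / r"
    have r: "r > 0" "r * r = w t" using w_pos[OF t] by (auto simp: r_def)
    have "0 \<le> ((x t + e) - y t) * (u1 t + u2 t)" "0 \<le> ((x t + e) + y t) * (u1 t - u2 t)"
      using u abs_y_le[OF t] e by (auto intro!: mult_nonneg_nonneg)
    then have "\<bar>(x t + e) * u2 t - y t * u1 t\<bar> \<le> (x t + e) * u1 t - y t * u2 t"
      by (auto simp: abs_if algebra_simps)
    then have AB: "\<bar>B\<bar> \<le> A" using r by (simp add: A_def B_def divide_right_mono)
    have "A\<^sup>2 - B\<^sup>2 = (((x t + e) * u1 t - y t * u2 t)\<^sup>2 - ((x t + e) * u2 t - y t * u1 t)\<^sup>2) / (r * r)"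
      by (simp only: A_def B_def power_divide diff_divide_distrib[symmetric] power2_eq_square[of r])
    also have "\<dots> = w t * ((u1 t)\<^sup>2 - (u2 t)\<^sup>2) / (r * r)"
      by (simp add: w_def power2_eq_square algebra_simps)
    also have "\<dots> = (u1 t)\<^sup>2 - (u2 t)\<^sup>2" using r w_pos[OF t] by simp
    finally have eq: "A\<^sup>2 - B\<^sup>2 = (u1 t)\<^sup>2 - (u2 t)\<^sup>2" .
    have "g t = sqrt (1 + (k * r / 2)\<^sup>2) * A - (k * r / 2) * B"
      using r(1) by (simp add: g_def h'_def r_def[symmetric] A_def B_def field_simps)
    with reverse_Cauchy_Schwarz[OF AB, of "k * r / 2"] eq
    have 2: "sqrt ((u1 t)\<^sup>2 - (u2 t)\<^sup>2) \<le> g t" by simp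
    have "(u2 t)\<^sup>2 \<le> (u1 t)\<^sup>2" using u by (simp add: abs_le_square_iff[symmetric])
    then have "0 \<le> sqrt ((u1 t)\<^sup>2 - (u2 t)\<^sup>2)" by simp
    then have "0 \<le> g t" using 2 by (rule order_trans)
    with 1 2 show ?case by blast
  qed
  have "has_bochner_integral (lebesgue_on {0..T}) g (F T - F 0)"
    by (rule has_bochner_integral_derivative[OF lip_F]) (use key in \<open>auto elim: eventually_mono\<close>)
  then have int: "integrable (lebesgue_on {0..T}) g" "integral\<^sup>L (lebesgue_on {0..T}) g = F T - F 0"
    by (auto simp: has_bochner_integral_iff)
  \<comment> \<open>This comparison asks for integrability of the larger function only. Since a
    nonintegrable function has integral 0, the larger one must also be nonnegative, which is why
    \<open>key\<close> records \<open>0 \<le> g t\<close>.\<close>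
  have "(LINT t|lebesgue_on {0..T}. sqrt ((u1 t)\<^sup>2 - (u2 t)\<^sup>2)) \<le> integral\<^sup>L (lebesgue_on {0..T}) g"
    by (rule integral_mono_AE'[OF int(1)]) (use key in \<open>auto elim: eventually_mono\<close>)
  also have "\<dots> = F T - F 0" by (rule int)
  finally show ?thesis using e start
    by (simp add: F_def h_def w_def power2_eq_square algebra_simps)
qed

text \<open>The translated bound is continuous in e, and the correction \<open>calib k e\<close>
  vanishes in the limit, so e may tend to 0 from the right even if the endpoint lies on the light
  cone.\<close>

lemma length_le:
  "(LINT t|lebesgue_on {0..T}. sqrt ((u1 t)\<^sup>2 - (u2 t)\<^sup>2)) \<le>
    calib k (sqrt ((x T)\<^sup>2 - (y T)\<^sup>2)) - k * z T" (is "?l \<le> _")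
proof -
  let ?B = "\<lambda>e. calib k (sqrt ((x T + e)\<^sup>2 - (y T)\<^sup>2)) - k * (z T + e * y T / 2) - calib k e"
  have "(?B \<longlongrightarrow> calib k (sqrt ((x T + 0)\<^sup>2 - (y T)\<^sup>2)) - k * (z T + 0 * y T / 2) - calib k 0) (at_right 0)"
    by (intro tendsto_intros isCont_tendsto_compose[OF isCont_calib]) auto
  then have lim: "(?B \<longlongrightarrow> calib k (sqrt ((x T)\<^sup>2 - (y T)\<^sup>2)) - k * z T) (at_right 0)"
    by simp
  have "\<forall>\<^sub>F e in at_right 0. ?l \<le> ?B e"
    using eventually_at_right_less[of "0::real"] by eventually_elim (rule length_le_shifted)
  then show ?thesis
    by (rule tendsto_lowerbound[OF lim]) simp
qed

lemma length_nonneg: "0 \<le> (LINT t|lebesgue_on {0..T}. sqrt ((u1 t)\<^sup>2 - (u2 t)\<^sup>2))"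
proof (rule integral_nonneg_AE)
  show "AE t in lebesgue_on {0..T}. 0 \<le> sqrt ((u1 t)\<^sup>2 - (u2 t)\<^sup>2)"
    using AE_der
  proof eventually_elim
    case (elim t)
    then have "\<bar>u2 t\<bar> \<le> \<bar>u1 t\<bar>" by auto
    then have "(u2 t)\<^sup>2 \<le> (u1 t)\<^sup>2" by (simp add: abs_le_square_iff[symmetric])
    then show ?case by simp
  qed
qed

text \<open>Integrability of the speed is essential here, because otherwise its integral would be 0
  by convention. It follows from the bound by \<open>u1\<close>, the almost everywhere derivative of
  a Lipschitz function.\<close>

lemma length_pos:
  assumes "0 < T" and strict: "AE t in lebesgue_on {0..T}. \<bar>u2 t\<bar> < u1 t"
  shows "0 < (LINT t|lebesgue_on {0..T}. sqrt ((u1 t)\<^sup>2 - (u2 t)\<^sup>2))"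
proof -
  let ?M = "lebesgue_on {0..T}" and ?v = "\<lambda>t. sqrt ((u1 t)\<^sup>2 - (u2 t)\<^sup>2)"
  have int: "integrable ?M u1" "integrable ?M u2"
    using has_bochner_integral_derivative[OF lip_x, of u1] has_bochner_integral_derivative[OF lip_y, of u2]
      AE_der by (auto simp: has_bochner_integral_iff elim!: eventually_mono)
  then have [measurable]: "u1 \<in> borel_measurable ?M" "u2 \<in> borel_measurable ?M"
    by auto
  have pos: "AE t in ?M. 0 < ?v t"
    using strict
  proof eventually_elim
    case (elim t)
    then show ?case using power_strict_mono[of "\<bar>u2 t\<bar>" "u1 t" 2] by simp
  qed
  have "integrable ?M ?v"
  proof (rule Bochner_Integration.integrable_bound[OF int(1)])
    show "AE t in ?M. norm (?v t) \<le> norm (u1 t)"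
      using AE_der
    proof eventually_elim
      case (elim t)
      then have "\<bar>u2 t\<bar> \<le> \<bar>u1 t\<bar>" by auto
      then have "(u2 t)\<^sup>2 \<le> (u1 t)\<^sup>2" by (simp add: abs_le_square_iff[symmetric])
      moreover have "sqrt ((u1 t)\<^sup>2 - (u2 t)\<^sup>2) \<le> \<bar>u1 t\<bar>"
        by (rule real_le_lsqrt) auto
      ultimately show ?case by (simp del: real_sqrt_le_iff)
    qed
  qed measurable
  moreover have "\<not> (AE t in ?M. ?v t = 0)"
  proof
    assume "AE t in ?M. ?v t = 0"
    with pos have "AE t in ?M. False" by eventually_elim simp
    then have "emeasure ?M (space ?M) = 0"
      by (simp add: eventually_False ae_filter_eq_bot_iff)
    then show False using assms(1) by (simp add: emeasure_restrict_space)
  qed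
  moreover have "AE t in ?M. 0 \<le> ?v t"
    using pos by eventually_elim (rule less_imp_le)
  ultimately have "integral\<^sup>L ?M ?v \<noteq> 0"
    using integral_nonneg_eq_0_iff_AE[of ?M ?v] by blast
  with length_nonneg show ?thesis by simp
qed

end

section \<open>The function \<open>\<alpha>\<close> and the value of the length bound\<close>

lemma less_sinh: "p < sinh p" if "0 < p" for p :: real
proof -
  have "0 - sinh 0 > p - sinh p"
  proof (rule DERIV_neg_imp_decreasing_open[OF that, where f = "\<lambda>p. p - sinh p"])
    fix t :: real assume t: "0 < t" "t < p"
    have "((\<lambda>p. p - sinh p) has_real_derivative 1 - cosh t) (at t)"
      by (auto intro!: derivative_eq_intros)
    moreover have "cosh t > 1" using t cosh_real_strict_mono[of 0 t] by simp
    ultimately show "\<exists>y. ((\<lambda>p. p - sinh p) has_real_derivative y) (at t) \<and> y < 0"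
      by (intro exI[of _ "1 - cosh t"]) auto
  qed (intro continuous_intros)
  then show ?thesis by simp
qed

lemma \<alpha>_minus: "\<alpha> (- p) = - \<alpha> p"
  by (simp add: \<alpha>_def minus_divide_left)

lemma \<alpha>_eq_0_iff: "\<alpha> p = 0 \<longleftrightarrow> p = 0"
proof -
  have "\<alpha> p > 0" if "p > 0" for p
    using less_sinh[of "2 * p"] that by (simp add: \<alpha>_def)
  from this[of p] this[of "- p"] show ?thesis
    by (cases p "0 :: real" rule: linorder_cases) (auto simp: \<alpha>_minus \<alpha>_def)
qed

lemma \<alpha>_surj_pos:
  assumes "0 < s" "s < 1 / 4"
  shows "s \<in> range \<alpha>"
proof -
  \<comment> \<open>The formula without the case distinction at 0 suits both the asymptotics and the
    continuity argument; it agrees with \<open>\<alpha>\<close> for positive p. Its limits 0 and 1/4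
    enclose s.\<close>
  define f where "f p = (sinh (2 * p) - 2 * p) / (8 * (sinh p)\<^sup>2)" for p :: real
  have "(f \<longlongrightarrow> 0) (at_right 0)" unfolding f_def by real_asymp
  then have "\<forall>\<^sub>F p in at_right 0. f p < s" by (rule order_tendstoD) (rule assms)
  moreover have "\<forall>\<^sub>F p in at_right (0::real). 0 < p" by (rule eventually_at_right_less)
  ultimately have "\<forall>\<^sub>F p in at_right 0. f p < s \<and> 0 < p" by eventually_elim simp
  then obtain a where a: "f a < s" "0 < a"
    using eventually_happens' trivial_limit_at_right_real by blast
  have "(f \<longlongrightarrow> 1 / 4) at_top" unfolding f_def by real_asymp (simp add: power2_eq_square)
  then have "\<forall>\<^sub>F p in at_top. s < f p" by (rule order_tendstoD) (rule assms)
  then have "\<forall>\<^sub>F p in at_top. s < f p \<and> a < p"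
    using eventually_gt_at_top[of a] by eventually_elim simp
  then obtain b where b: "s < f b" "a < b"
    using eventually_happens' trivial_limit_at_top_linorder by blast
  have "\<exists>p\<ge>a. p \<le> b \<and> f p = s"
  proof (rule IVT')
    show "continuous_on {a..b} f"
      unfolding f_def using a by (intro continuous_intros) auto
  qed (use a b in auto)
  then obtain p where "p \<ge> a" "f p = s" by blast
  then have "\<alpha> p = s" using a by (auto simp: \<alpha>_def f_def)
  then show ?thesis by blast
qed

lemma \<alpha>_inv:
  assumes "\<bar>s\<bar> < 1 / 4"
  shows "\<alpha> (inv \<alpha> s) = s"
proof -
  have "s \<in> range \<alpha>"
  proof (cases s "0 :: real" rule: linorder_cases)
    case less
    then have "- s \<in> range \<alpha>" using assms by (intro \<alpha>_surj_pos) auto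
    then obtain p where "- s = \<alpha> p" by blast
    then have "s = \<alpha> (- p)" by (simp add: \<alpha>_minus)
    then show ?thesis by blast
  next
    case equal
    then show ?thesis using \<alpha>_eq_0_iff[of 0] rangeI[of \<alpha> 0] by simp
  next
    case greater
    then show ?thesis using assms by (intro \<alpha>_surj_pos) auto
  qed
  then show ?thesis by (rule f_inv_into_f)
qed

text \<open>This multiplier gives k r / 2 = sinh p, which turns the inverse hyperbolic sine in
  \<open>calib\<close> into p and the square root into cosh p.\<close>

lemma calib_sinh:
  assumes "0 < r" "p \<noteq> 0"
  shows "calib (2 * sinh p / r) r - 2 * sinh p / r * z
    = r * ((p / sinh p + cosh p) / 2 - 2 * sinh p * (z / r\<^sup>2))"
proof -
  have "sqrt (1 + (sinh p)\<^sup>2) = cosh p"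
    by (rule real_sqrt_unique) (simp_all add: cosh_square_eq)
  moreover have "2 * sinh p / r * r / 2 = sinh p" using assms by simp
  ultimately have "calib (2 * sinh p / r) r = p / (2 * sinh p / r) + r / 2 * cosh p"
    using assms by (simp add: calib_def arsinh_sinh_real)
  then show ?thesis using assms by (simp add: field_simps power2_eq_square)
qed

text \<open>By the double angle formula 2 sinh p \<open>\<alpha> p\<close> equals (cosh p - p / sinh
  p) / 2 for nonzero p, so the cosh terms cancel.\<close>

lemma calib_sinh_\<alpha>:
  assumes "0 < r" "z = r\<^sup>2 * \<alpha> p"
  shows "calib (2 * sinh p / r) r - 2 * sinh p / r * z = r * over_sinh (ereal p)"
proof (cases "p = 0")
  case True
  then show ?thesis by (simp add: over_sinh_def calib_def)
next
  case False
  have "(p / sinh p + cosh p) / 2 - 2 * sinh p * \<alpha> p = p / sinh p"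
    unfolding \<alpha>_def sinh_double using False by (simp add: field_simps power2_eq_square)
  moreover have "z / r\<^sup>2 = \<alpha> p" using assms by simp
  ultimately show ?thesis
    unfolding calib_sinh[OF assms(1) False] using False by (simp add: over_sinh_def zero_ereal_def)
qed

lemma over_sinh_pos: "0 < over_sinh (ereal p)"
  by (cases p "0 :: real" rule: linorder_cases)
     (auto simp: over_sinh_def zero_ereal_def divide_neg_neg)

lemma over_sinh_eq_1_iff: "over_sinh (ereal p) = 1 \<longleftrightarrow> p = 0"
  using less_sinh[of p] less_sinh[of "- p"]
  by (cases p "0 :: real" rule: linorder_cases)
     (auto simp: over_sinh_def zero_ereal_def divide_eq_eq)

section \<open>Admissible trajectories in coordinates and the optimal arcs\<close>

lemma admissible_smooth:
  fixes x y z u1 u2 :: "real \<Rightarrow> real"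
  assumes "\<And>t. (x has_real_derivative u1 t) (at t)"
    and "\<And>t. (y has_real_derivative u2 t) (at t)"
    and "\<And>t. (z has_real_derivative (x t * u2 t - y t * u1 t) / 2) (at t)"
    and cont: "continuous_on UNIV u1" "continuous_on UNIV u2"
    and "\<And>t. \<bar>u2 t\<bar> \<le> u1 t" and T: "0 \<le> T"
  shows "admissible T (\<lambda>t. (x t, y t, z t)) u1 u2"
proof -
  have "continuous_on UNIV x" "continuous_on UNIV y"
    using assms(1,2) by (meson DERIV_isCont continuous_at_imp_continuous_on)+
  then have "continuous_on UNIV (\<lambda>t. (x t * u2 t - y t * u1 t) / 2)"
    using cont by (intro continuous_intros) auto
  then obtain A B C where ABC: "A-lipschitz_on {0..T} x" "B-lipschitz_on {0..T} y" "C-lipschitz_on {0..T} z"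
    using C1_imp_lipschitz_on_Icc[of 0 T x u1] C1_imp_lipschitz_on_Icc[of 0 T y u2]
      C1_imp_lipschitz_on_Icc[of 0 T z "\<lambda>t. (x t * u2 t - y t * u1 t) / 2"] assms
    by (meson continuous_on_subset subset_UNIV)
  then have lip: "\<exists>L. L-lipschitz_on {0..T} (\<lambda>t. (x t, y t, z t))"
    using lipschitz_on_Pair[OF ABC(1) lipschitz_on_Pair[OF ABC(2,3)]] by blast
  have "((\<lambda>t. (x t, y t, z t)) has_vector_derivative
      (u1 t *\<^sub>R X1 (x t, y t, z t) + u2 t *\<^sub>R X2 (x t, y t, z t))) (at t within {0..T})" for t
  proof -
    have "((\<lambda>t. (x t, y t, z t)) has_vector_derivative
        (u1 t, u2 t, (x t * u2 t - y t * u1 t) / 2)) (at t within {0..T})"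
      using assms(1-3)[of t]
      by (intro has_vector_derivative_Pair)
         (auto simp: has_real_derivative_iff_has_vector_derivative intro: has_vector_derivative_at_within)
    then show ?thesis by (simp add: field_simps)
  qed
  then show ?thesis
    unfolding admissible_def using T lip assms(6) by auto
qed

lemma admissible_imp_causal_curve:
  assumes "admissible T q u1 u2" "q 0 = q0"
  shows "causal_curve T (\<lambda>t. fst (q t)) (\<lambda>t. fst (snd (q t))) (\<lambda>t. snd (snd (q t))) u1 u2"
proof
  show "0 \<le> T" using assms by (simp add: admissible_def)
  obtain L where L: "L-lipschitz_on {0..T} q" using assms by (auto simp: admissible_def)
  have 1: "dist (fst a) (fst b) \<le> dist a b" "dist (fst (snd a)) (fst (snd b)) \<le> dist a b"
    "dist (snd (snd a)) (snd (snd b)) \<le> dist a b" for a b :: point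
    by (meson dist_fst_le dist_snd_le order_trans)+
  show "\<exists>L. L-lipschitz_on {0..T} (\<lambda>t. fst (q t))" "\<exists>L. L-lipschitz_on {0..T} (\<lambda>t. fst (snd (q t)))"
    "\<exists>L. L-lipschitz_on {0..T} (\<lambda>t. snd (snd (q t)))"
    using L 1 unfolding lipschitz_on_def by (meson order_trans)+
  have der: "AE t in lebesgue_on {0..T}.
      (q has_vector_derivative (u1 t *\<^sub>R X1 (q t) + u2 t *\<^sub>R X2 (q t))) (at t within {0..T}) \<and>
      \<bar>u2 t\<bar> \<le> u1 t"
    using assms by (simp add: admissible_def)
  then show "AE t in lebesgue_on {0..T}.
      ((\<lambda>t. fst (q t)) has_real_derivative u1 t) (at t within {0..T}) \<and>
      ((\<lambda>t. fst (snd (q t))) has_real_derivative u2 t) (at t within {0..T}) \<and>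
      ((\<lambda>t. snd (snd (q t))) has_real_derivative
         (fst (q t) * u2 t - fst (snd (q t)) * u1 t) / 2) (at t within {0..T}) \<and>
      \<bar>u2 t\<bar> \<le> u1 t"
  proof eventually_elim
    case (elim t)
    obtain a b c where q: "q t = (a, b, c)" by (cases "q t")
    have d: "(q has_vector_derivative (u1 t, u2 t, (a * u2 t - b * u1 t) / 2)) (at t within {0..T})"
      using elim by (simp add: q field_simps)
    note snd_d = bounded_linear.has_vector_derivative[OF bounded_linear_snd d]
    show ?case
      using bounded_linear.has_vector_derivative[OF bounded_linear_fst d]
        bounded_linear.has_vector_derivative[OF bounded_linear_fst snd_d]
        bounded_linear.has_vector_derivative[OF bounded_linear_snd snd_d] elim
      by (simp add: q has_real_derivative_iff_has_vector_derivative)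
  qed
qed (use assms in \<open>simp_all add: q0_def\<close>)

lemma sl_length_const:
  assumes "\<And>t. (u1 t)\<^sup>2 - (u2 t)\<^sup>2 = c\<^sup>2" "0 \<le> c"
  shows "sl_length 1 u1 u2 = c"
  using assms by (simp add: sl_length_def measure_restrict_space)

text \<open>In the Minkowski plane the optimal curve is an arc of the hyperbola with
  rapidity running over an interval of length \<open>2 p\<close> centred at the rapidity of \<open>(x, y)\<close>.\<close>

lemma optimal_curve:
  assumes xy: "\<bar>y\<bar> < x" and z: "z = (x\<^sup>2 - y\<^sup>2) * \<alpha> p"
  shows "\<exists>q u1 u2. admissible 1 q u1 u2 \<and> (\<forall>t. \<bar>u2 t\<bar> < u1 t) \<and> q 0 = q0 \<and> q 1 = (x, y, z) \<and>
    sl_length 1 u1 u2 = sqrt (x\<^sup>2 - y\<^sup>2) * over_sinh (ereal p)"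
proof (cases "p = 0")
  case True
  \<comment> \<open>The rapidity is constant and the arc degenerates to a segment; the formulas of
    the other case divide by p.\<close>
  have "admissible 1 (\<lambda>t. (x * t, y * t, 0)) (\<lambda>t. x) (\<lambda>t. y)"
    by (rule admissible_smooth) (use xy in \<open>auto intro!: derivative_eq_intros\<close>)
  moreover have pos: "x\<^sup>2 - y\<^sup>2 > 0" using xy power_strict_mono[of "\<bar>y\<bar>" x 2] by simp
  moreover have "sl_length 1 (\<lambda>t. x) (\<lambda>t. y) = sqrt (x\<^sup>2 - y\<^sup>2)"
    by (rule sl_length_const) (use pos in auto)
  ultimately show ?thesis using xy z True
    by (intro exI[of _ "\<lambda>t. (x * t, y * t, 0)"] exI[of _ "\<lambda>t. x"] exI[of _ "\<lambda>t. y"])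
       (auto simp: q0_def over_sinh_def \<alpha>_def)
next
  case False
  define r where "r = sqrt (x\<^sup>2 - y\<^sup>2)"
  have pos: "x\<^sup>2 - y\<^sup>2 > 0" using xy power_strict_mono[of "\<bar>y\<bar>" x 2] by simp
  then have r: "r > 0" "r\<^sup>2 = x\<^sup>2 - y\<^sup>2" by (auto simp: r_def)
  define a where "a = arsinh (y / r)"
  have y_eq: "y = r * sinh a" using r by (simp add: a_def)
  have sq: "(r * cosh a)\<^sup>2 = x\<^sup>2"
    using r(2) unfolding y_eq by (simp add: power_mult_distrib cosh_square_eq algebra_simps)
  have "r * cosh a = x"
  proof (rule power2_eq_imp_eq[OF sq])
    show "0 \<le> r * cosh a" using r(1) by simp
    show "0 \<le> x" using xy by linarith
  qed
  then have x_eq: "x = r * cosh a" by (rule sym)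
  \<comment> \<open>Integrating a velocity of norm c with rapidity from a - p to a + p gives a chord
    of norm c sinh p / p and rapidity a; equating this norm with r determines c.\<close>
  define c where "c = r * (p / sinh p)"
  have "0 < p / sinh p" using over_sinh_pos[of p] False by (simp add: over_sinh_def zero_ereal_def)
  then have c: "c > 0" unfolding c_def using r(1) by (intro mult_pos_pos)
  define u1 u2 where "u1 t = c * cosh (a + p * (2 * t - 1))"
    and "u2 t = c * sinh (a + p * (2 * t - 1))" for t
  \<comment> \<open>\<open>X\<close> and \<open>Y\<close> are the integrals of the controls,
    \<open>Z\<close> is the area they sweep. With the above c, \<open>Z 1\<close> is r^2 times (sinh
    (2 p) - 2 p) / (8 (sinh p)^2), so \<open>\<alpha> p\<close> is the area belonging to a unit
    chord.\<close>
  define X Y Z where "X t = c * (sinh (a + p * (2 * t - 1)) - sinh (a - p)) / (2 * p)"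
    and "Y t = c * (cosh (a + p * (2 * t - 1)) - cosh (a - p)) / (2 * p)"
    and "Z t = c\<^sup>2 / (8 * p\<^sup>2) * (sinh (2 * p * t) - 2 * p * t)" for t
  have u: "\<bar>u2 t\<bar> < u1 t" for t
  proof -
    have "\<bar>sinh v\<bar> < cosh v" for v :: real
      using sinh_less_cosh_real[of v] sinh_less_cosh_real[of "- v"] by auto
    then show ?thesis using c by (simp add: u1_def u2_def abs_mult)
  qed
  have "admissible 1 (\<lambda>t. (X t, Y t, Z t)) u1 u2"
  proof (rule admissible_smooth)
    show "(X has_real_derivative u1 t) (at t)" "(Y has_real_derivative u2 t) (at t)" for t
      unfolding X_def Y_def u1_def u2_def using False by (auto intro!: derivative_eq_intros)
    show "(Z has_real_derivative (X t * u2 t - Y t * u1 t) / 2) (at t)" for t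
    proof -
      define b where "b = a + p * (2 * t - 1)"
      have "X t * u2 t - Y t * u1 t = c * c / (2 * p) *
          ((sinh b - sinh (a - p)) * sinh b - (cosh b - cosh (a - p)) * cosh b)"
        unfolding X_def Y_def u1_def u2_def b_def[symmetric] using False by (simp add: field_simps)
      also have "(sinh b - sinh (a - p)) * sinh b - (cosh b - cosh (a - p)) * cosh b
          = cosh (b - (a - p)) - 1"
        using hyperbolic_pythagoras[of b] unfolding cosh_diff[of b "a - p"]
        by (simp add: algebra_simps power2_eq_square)
      also have "b - (a - p) = 2 * p * t" by (simp add: b_def algebra_simps)
      finally have eq: "(X t * u2 t - Y t * u1 t) / 2 = c * c / (4 * p) * (cosh (2 * p * t) - 1)"
        by simp
      have "(Z has_real_derivative c\<^sup>2 / (8 * p\<^sup>2) * (cosh (2 * p * t) * (2 * p) - 2 * p)) (at t)"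
        unfolding Z_def by (rule DERIV_cmult) (auto intro!: derivative_eq_intros)
      also have "c\<^sup>2 / (8 * p\<^sup>2) * (cosh (2 * p * t) * (2 * p) - 2 * p) = (X t * u2 t - Y t * u1 t) / 2"
        unfolding eq using False by (simp add: field_simps power2_eq_square)
      finally show ?thesis .
    qed
    show "continuous_on UNIV u1" "continuous_on UNIV u2"
      unfolding u1_def u2_def by (intro continuous_intros)+
    show "\<bar>u2 t\<bar> \<le> u1 t" for t using u less_imp_le by blast
  qed simp
  moreover have "(X 0, Y 0, Z 0) = q0" by (simp add: X_def Y_def Z_def q0_def)
  moreover have "(X 1, Y 1, Z 1) = (x, y, z)"
  proof -
    have "X 1 = x" "Y 1 = y"
      unfolding X_def Y_def x_eq y_eq c_def using False
      by (simp_all add: sinh_add sinh_diff cosh_add cosh_diff field_simps)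
    moreover have "Z 1 = z"
      unfolding Z_def z r(2)[symmetric] c_def using False by (simp add: \<alpha>_def field_simps power2_eq_square)
    ultimately show ?thesis by simp
  qed
  moreover have "sl_length 1 u1 u2 = c"
  proof (rule sl_length_const)
    show "(u1 t)\<^sup>2 - (u2 t)\<^sup>2 = c\<^sup>2" for t
      by (simp add: u1_def u2_def power_mult_distrib cosh_square_eq algebra_simps)
  qed (use c in simp)
  moreover have "c = r * over_sinh (ereal p)"
    using False by (simp add: c_def over_sinh_def zero_ereal_def)
  ultimately show ?thesis using u unfolding r_def by metis
qed

section \<open>From lengths to the distance\<close>

lemma sl_length_le:
  assumes "admissible T q u1 u2" "q 0 = q0" "q T = (x, y, z)"
  shows "sl_length T u1 u2 \<le> calib k (sqrt (x\<^sup>2 - y\<^sup>2)) - k * z"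
  using causal_curve.length_le[OF admissible_imp_causal_curve[OF assms(1,2)], of k] assms(3)
  by (simp add: sl_length_def)

lemma sl_length_nonneg:
  assumes "admissible T q u1 u2" "q 0 = q0"
  shows "0 \<le> sl_length T u1 u2"
  using causal_curve.length_nonneg[OF admissible_imp_causal_curve[OF assms]] by (simp add: sl_length_def)

lemma causal_future_cone:
  assumes "(x, y, z) \<in> causal_future q0"
  shows "\<bar>y\<bar> \<le> x" "4 * \<bar>z\<bar> \<le> x\<^sup>2 - y\<^sup>2"
proof -
  obtain T q u1 u2 where q: "admissible T q u1 u2" "q 0 = q0" "q T = (x, y, z)"
    using assms by (auto simp: causal_future_def)
  interpret causal_curve T "\<lambda>t. fst (q t)" "\<lambda>t. fst (snd (q t))" "\<lambda>t. snd (snd (q t))" u1 u2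
    by (rule admissible_imp_causal_curve[OF q(1,2)])
  show "\<bar>y\<bar> \<le> x" "4 * \<bar>z\<bar> \<le> x\<^sup>2 - y\<^sup>2"
    using endpoint_abs_y_le cone q by auto
qed

lemma sl_dist_eqI:
  assumes "\<And>T q u1 u2. admissible T q u1 u2 \<Longrightarrow> q 0 = q0 \<Longrightarrow> q T = b \<Longrightarrow> sl_length T u1 u2 \<le> d"
    and "\<exists>T q u1 u2. admissible T q u1 u2 \<and> q 0 = q0 \<and> q T = b \<and> d \<le> sl_length T u1 u2"
  shows "sl_dist q0 b = ereal d"
  unfolding sl_dist_def
proof (rule antisym)
  show "Sup {ereal (sl_length t1 u1 u2) |t1 q u1 u2. admissible t1 q u1 u2 \<and> q 0 = q0 \<and> q t1 = b} \<le> ereal d"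
    using assms(1) by (intro Sup_least) auto
  obtain T q u1 u2 where q: "admissible T q u1 u2" "q 0 = q0" "q T = b" "d \<le> sl_length T u1 u2"
    using assms(2) by blast
  have "ereal d \<le> ereal (sl_length T u1 u2)" using q by simp
  also have "\<dots> \<le> Sup {ereal (sl_length t1 u1 u2) |t1 q u1 u2. admissible t1 q u1 u2 \<and> q 0 = q0 \<and> q t1 = b}"
    using q by (intro Sup_upper) blast
  finally show "ereal d \<le> Sup {ereal (sl_length t1 u1 u2) |t1 q u1 u2. admissible t1 q u1 u2 \<and> q 0 = q0 \<and> q t1 = b}" .
qed

lemma sl_dist_pos_if_chronological:
  assumes "b \<in> chronological_future q0"
  shows "0 < sl_dist q0 b"
proof -
  obtain T q u1 u2 where q: "0 < T" "admissible T q u1 u2" "AE t in lebesgue_on {0..T}. \<bar>u2 t\<bar> < u1 t"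
    "q 0 = q0" "q T = b"
    using assms by (auto simp: chronological_future_def)
  interpret causal_curve T "\<lambda>t. fst (q t)" "\<lambda>t. fst (snd (q t))" "\<lambda>t. snd (snd (q t))" u1 u2
    by (rule admissible_imp_causal_curve[OF q(2,4)])
  have "0 < ereal (sl_length T u1 u2)"
    using length_pos[OF q(1,3)] by (simp add: sl_length_def)
  also have "\<dots> \<le> sl_dist q0 b"
    unfolding sl_dist_def using q by (intro Sup_upper) blast
  finally show ?thesis .
qed

text \<open>The calibration bound and the length of the arc coincide, so the supremum is attained;
  the same arc has strict controls and witnesses chronological reachability.\<close>

lemma sl_dist_interior:
  assumes "\<bar>y\<bar> < x" "z = (x\<^sup>2 - y\<^sup>2) * \<alpha> p"
  shows "sl_dist q0 (x, y, z) = ereal (sqrt (x\<^sup>2 - y\<^sup>2) * over_sinh (ereal p))"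
    and "(x, y, z) \<in> chronological_future q0"
proof -
  let ?r = "sqrt (x\<^sup>2 - y\<^sup>2)"
  have "x\<^sup>2 - y\<^sup>2 > 0" using assms(1) power_strict_mono[of "\<bar>y\<bar>" x 2] by simp
  then have r: "0 < ?r" "z = ?r\<^sup>2 * \<alpha> p" using assms(2) by auto
  obtain q u1 u2 where q: "admissible 1 q u1 u2" "\<forall>t. \<bar>u2 t\<bar> < u1 t" "q 0 = q0" "q 1 = (x, y, z)"
    "sl_length 1 u1 u2 = ?r * over_sinh (ereal p)"
    using optimal_curve[OF assms] by blast
  show "sl_dist q0 (x, y, z) = ereal (?r * over_sinh (ereal p))"
  proof (rule sl_dist_eqI)
    show "sl_length T u1 u2 \<le> ?r * over_sinh (ereal p)"
      if "admissible T q u1 u2" "q 0 = q0" "q T = (x, y, z)" for T q u1 u2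
      using sl_length_le[OF that, of "2 * sinh p / ?r"] calib_sinh_\<alpha>[OF r] by simp
    show "\<exists>T q u1 u2. admissible T q u1 u2 \<and> q 0 = q0 \<and> q T = (x, y, z) \<and>
        ?r * over_sinh (ereal p) \<le> sl_length T u1 u2"
      using q order_refl by metis
  qed
  show "(x, y, z) \<in> chronological_future q0"
  proof -
    have "AE t in lebesgue_on {0..1}. \<bar>u2 t\<bar> < u1 t" using q(2) by simp
    then show ?thesis
      unfolding chronological_future_def mem_Collect_eq using q zero_less_one by blast
  qed
qed

lemma sl_dist_boundary:
  assumes J: "(x, y, z) \<in> causal_future q0" and eq: "4 * \<bar>z\<bar> = x\<^sup>2 - y\<^sup>2"
  shows "sl_dist q0 (x, y, z) = 0"
proof -
  let ?r = "sqrt (x\<^sup>2 - y\<^sup>2)"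
  have "sl_length T u1 u2 \<le> 0" if q: "admissible T q u1 u2" "q 0 = q0" "q T = (x, y, z)" for T q u1 u2
  proof (cases "x\<^sup>2 - y\<^sup>2 = 0")
    case True
    then show ?thesis using sl_length_le[OF q, of 0] by simp
  next
    case False
    then have r: "0 < ?r" using eq by simp
    have s: "z / ?r\<^sup>2 = sgn z / 4" "sgn z = 1 \<or> sgn z = - 1" using eq False by (auto simp: sgn_if abs_if field_simps split: if_splits)
    \<comment> \<open>This equals r (p / sinh p + exp (- p)) / 2. Taking the multiplier for sgn z *
      p makes the bounds for both signs of z coincide.\<close>
    let ?B = "\<lambda>p. ?r * ((p / sinh p + cosh p) / 2 - sinh p / 2)"
    have ev: "\<forall>\<^sub>F p in at_top. sl_length T u1 u2 \<le> ?B p"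
      using eventually_gt_at_top[of 0]
    proof eventually_elim
      case (elim p)
      then have "sgn z * p \<noteq> 0" using s(2) by auto
      then have "sl_length T u1 u2 \<le> ?r * ((sgn z * p / sinh (sgn z * p) + cosh (sgn z * p)) / 2 -
          2 * sinh (sgn z * p) * (sgn z / 4))"
        using sl_length_le[OF q, of "2 * sinh (sgn z * p) / ?r"] calib_sinh[OF r, of "sgn z * p" z] s(1)
        by simp
      also have "\<dots> = ?B p"
        using s(2) by auto
      finally show ?case .
    qed
    have lim: "(?B \<longlongrightarrow> ?r * 0) at_top"
      by (intro tendsto_mult tendsto_const) real_asymp
    show ?thesis
      using tendsto_lowerbound[OF lim ev] by simp
  qed
  \<comment> \<open>A supremum over the empty set would be minus infinity, so some trajectory must
    exist; its length is nonnegative.\<close>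
  moreover have "\<exists>T q u1 u2. admissible T q u1 u2 \<and> q 0 = q0 \<and> q T = (x, y, z) \<and> 0 \<le> sl_length T u1 u2"
    using J sl_length_nonneg by (fastforce simp: causal_future_def)
  ultimately show ?thesis
    using sl_dist_eqI[of "(x, y, z)" 0] by (simp add: zero_ereal_def)
qed

theorem theorem9:
  fixes x y z :: real
  assumes "(x, y, z) \<in> causal_future q0"
  shows "sl_dist q0 (x, y, z) =
           ereal (sqrt (x\<^sup>2 - y\<^sup>2) * over_sinh (\<beta> (z / (x\<^sup>2 - y\<^sup>2)))) \<and>
         (z = 0 \<longleftrightarrow> sl_dist q0 (x, y, z) = ereal (sqrt (x\<^sup>2 - y\<^sup>2))) \<and>
         ((x, y, z) \<in> causal_future q0 - chronological_future q0 \<longleftrightarrow>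
           sl_dist q0 (x, y, z) = 0)"
proof (cases "4 * \<bar>z\<bar> = x\<^sup>2 - y\<^sup>2")
  case True
  then have d: "sl_dist q0 (x, y, z) = 0" by (rule sl_dist_boundary[OF assms])
  then have "(x, y, z) \<notin> chronological_future q0"
    using sl_dist_pos_if_chronological by force
  moreover have "sqrt (x\<^sup>2 - y\<^sup>2) * over_sinh (\<beta> (z / (x\<^sup>2 - y\<^sup>2))) = 0"
  \<comment> \<open>On the boundary z = 0 forces x^2 = y^2. The argument of \<open>\<beta>\<close>
    is then 0 / 0 = 0 by convention, and the factor sqrt 0 annihilates the value of
    \<open>over_sinh\<close>.\<close>
  proof (cases "z = 0")
    case False
    then have "z / (x\<^sup>2 - y\<^sup>2) = 1 / 4 \<or> z / (x\<^sup>2 - y\<^sup>2) = - 1 / 4"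
      unfolding True[symmetric] by (auto simp: abs_if)
    then show ?thesis by (auto simp: \<beta>_def over_sinh_def)
  qed (use True in simp)
  moreover have "z = 0 \<longleftrightarrow> sqrt (x\<^sup>2 - y\<^sup>2) = 0" using True by auto
  ultimately show ?thesis using d assms by (auto simp: zero_ereal_def)
next
  case False
  let ?s = "z / (x\<^sup>2 - y\<^sup>2)"
  have D: "4 * \<bar>z\<bar> < x\<^sup>2 - y\<^sup>2" "\<bar>y\<bar> \<le> x" using False causal_future_cone[OF assms] by auto
  then have pos: "x\<^sup>2 - y\<^sup>2 > 0" by linarith
  then have xy: "\<bar>y\<bar> < x" using D(2) by (cases "\<bar>y\<bar> = x") auto
  have s: "\<bar>?s\<bar> < 1 / 4" using D(1) pos by (simp add: field_simps)
  define p where "p = inv \<alpha> ?s"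
  have \<alpha>: "\<alpha> p = ?s" unfolding p_def by (rule \<alpha>_inv[OF s])
  then have z: "z = (x\<^sup>2 - y\<^sup>2) * \<alpha> p" using pos by simp
  have "?s \<noteq> 1 / 4" "?s \<noteq> - 1 / 4" using s by linarith+
  then have \<beta>: "\<beta> ?s = ereal p" by (simp only: \<beta>_def p_def if_False)
  note d = sl_dist_interior[OF xy z]
  \<comment> \<open>Inside the cone the distance is sqrt (x^2 - y^2) exactly when p / sinh p has the
    value 1, that is p = 0. It is never 0 and the point is chronologically reachable, so both sides
    of the last equivalence are false.\<close>
  have "z = 0 \<longleftrightarrow> p = 0" using \<alpha> \<alpha>_eq_0_iff[of p] pos by auto
  then show ?thesis
    using d pos over_sinh_pos[of p] over_sinh_eq_1_iff[of p] by (simp add: \<beta> zero_ereal_def)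
qed

end
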